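(* Let $\alpha>-1$ and $\beta\in(0,1+\alpha]$. If $f=h+\overline{g}\in\mathcal{B}_{\mathcal{H}}^0(\alpha,\beta)$, then $$|z|-\frac{\beta}{2(1+\alpha)}|z|^2\le |f(z)|\le |z|+\frac{\beta}{2(1+\alpha)}|z|^2,\qquad z\in\mathbb{D}.$$ Both inequalities are sharp for the functions $$f_1(z)=z+\frac{\beta}{2(1+\alpha)}z^2\quad\text{and}\quad f_2(z)=z+\frac{\beta}{2(1+\alpha)}\overline{z}^{\,2}$$ and their rotations.
   Context: $\mathbb{D}=\{z\in\mathbb{C}:|z|<1\}$. $\mathcal{H}^0$ is the class of harmonic mappings $f=h+\overline{g}$ in $\mathbb{D}$, where $h,g$ are analytic in $\mathbb{D}$ with $h(0)=g(0)=0$, $h'(0)=1$ and $g'(0)=0$. For $\alpha>-1$ and $\beta>0$, $\mathcal{B}_{\mathcal{H}}^0(\alpha,\beta)$ is the set of $f=h+\overline{g}\in\mathcal{H}^0$ such that $|zh''(z)+\alpha(h'(z)-1)|\le \beta-|zg''(z)+\alpha g'(z)|$ for all $z\in\mathbb{D}$. "Sharp for a function" means that the function belongs to the class and, for each $r\in(0,1)$, equality is attained in each of the inequalities at some point with $|z|=r$. The rotations of $f$ are the functions $z\mapsto e^{-i\theta}f(e^{i\theta}z)$, $\theta\in\mathbb{R}$. *)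

theory Defs
  imports "HOL-Complex_Analysis.Complex_Analysis"
begin

text \<open>
  A harmonic mapping of the unit disk is a function \<open>complex \<Rightarrow> complex\<close> of which only the values
  on \<open>ball 0 1\<close> matter.  The normalised analytic and co-analytic parts \<open>h\<close>, \<open>g\<close> are uniquely
  determined by \<open>f\<close> on \<open>ball 0 1\<close>.
\<close>

definition harmonic_decomp :: "(complex \<Rightarrow> complex) \<Rightarrow> (complex \<Rightarrow> complex) \<Rightarrow> (complex \<Rightarrow> complex) \<Rightarrow> bool"
  where "harmonic_decomp f h g \<longleftrightarrow>
    h holomorphic_on ball 0 1 \<and> g holomorphic_on ball 0 1 \<and>
    h 0 = 0 \<and> g 0 = 0 \<and> deriv h 0 = 1 \<and> deriv g 0 = 0 \<and>
    (\<forall>z\<in>ball 0 1. f z = h z + cnj (g z))"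

definition class_H0 :: "(complex \<Rightarrow> complex) set"
  where "class_H0 = {f. \<exists>h g. harmonic_decomp f h g}"

definition class_BH0 :: "real \<Rightarrow> real \<Rightarrow> (complex \<Rightarrow> complex) set"
  where "class_BH0 \<alpha> \<beta> = {f \<in> class_H0. \<exists>h g. harmonic_decomp f h g \<and>
    (\<forall>z\<in>ball 0 1.
      norm (z * deriv (deriv h) z + of_real \<alpha> * (deriv h z - 1))
        \<le> \<beta> - norm (z * deriv (deriv g) z + of_real \<alpha> * deriv g z))}"

text \<open>The set of rotations of \<open>f\<close> contains \<open>f\<close> itself (\<open>\<theta> = 0\<close>).\<close>

definition rotations :: "(complex \<Rightarrow> complex) \<Rightarrow> (complex \<Rightarrow> complex) set"
  where "rotations f = {\<lambda>z. exp (- (\<i> * of_real \<theta>)) * f (exp (\<i> * of_real \<theta>) * z) | \<theta>::real. True}"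

text \<open>
  Sharpness, for a member \<open>f\<close> of the class \<open>F\<close>, of the bounds
  \<open>lo (norm z) \<le> norm (f z) \<le> hi (norm z)\<close> on the unit disk: both bounds are attained on every
  circle, possibly at different points.
\<close>

definition sharp_for ::
    "(complex \<Rightarrow> complex) set \<Rightarrow> (real \<Rightarrow> real) \<Rightarrow> (real \<Rightarrow> real) \<Rightarrow> (complex \<Rightarrow> complex) \<Rightarrow> bool"
  where "sharp_for F lo hi f \<longleftrightarrow> f \<in> F \<and>
    (\<forall>r\<in>{0<..<1}. (\<exists>z. norm z = r \<and> norm (f z) = lo r) \<and>
                   (\<exists>z. norm z = r \<and> norm (f z) = hi r))"

end

theory Submission
  imports Defs
begin

text \<open>
  For unimodular \<open>\<epsilon>\<close>, the function \<open>u = h - z + \<epsilon> g\<close> satisfies \<open>\<bar>z u'' + \<alpha> u'\<bar> \<le> \<beta>\<close>, hence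
  \<open>\<le> \<beta> \<bar>z\<bar>\<close> by the Schwarz lemma.  Since \<open>z u'' + \<alpha> u'\<close> is, up to a power of \<open>t\<close>, the derivative of
  \<open>t\<^sup>\<alpha> u'(t z)\<close> at \<open>t = 1\<close>, integrating along the ray gives \<open>\<bar>u'\<bar> \<le> \<beta> \<bar>z\<bar> / (1 + \<alpha>)\<close>, and a
  second integration gives \<open>\<bar>u\<bar> \<le> \<beta> \<bar>z\<bar>\<^sup>2 / (2 (1 + \<alpha>))\<close>.  For a suitable \<open>\<epsilon>\<close>, depending on the
  point, \<open>\<bar>u\<bar>\<close> is \<open>\<bar>f - z\<bar>\<close>.
\<close>

section \<open>Radial estimates for holomorphic functions on the disk\<close>

lemma Schwarz_Lemma_le:
  fixes w :: "complex \<Rightarrow> complex"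
  assumes hol: "w holomorphic_on ball 0 1" and "w 0 = 0"
    and bound: "\<And>z. norm z < 1 \<Longrightarrow> norm (w z) \<le> c"
    and z: "norm z < 1"
  shows "norm (w z) \<le> c * norm z"
proof (cases "z = 0")
  case True
  then show ?thesis using \<open>w 0 = 0\<close> by simp
next
  case False
  \<comment> \<open>The classical Schwarz lemma wants values strictly inside the unit disk, so
    \<open>w\<close> is divided by an arbitrary \<open>d > c\<close>, which also covers
    \<open>c = 0\<close>; then \<open>d\<close> decreases to \<open>c\<close>.\<close>
  have "norm (w z) / norm z \<le> c"
  proof (rule dense_ge)
    fix d assume "c < d"
    have "0 \<le> c" using bound[of 0] by (simp add: order_trans[OF norm_ge_zero])
    with \<open>c < d\<close> have "0 < d" by simp
    have "norm (w z / of_real d) \<le> norm z"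
    proof (rule Schwarz_Lemma(1)[where f = "\<lambda>z. w z / of_real d"])
      show "(\<lambda>z. w z / of_real d) holomorphic_on ball 0 1"
        using hol \<open>0 < d\<close> by (intro holomorphic_intros) auto
      show "norm (w z / of_real d) < 1" if "norm z < 1" for z
        using bound[OF that] \<open>0 < d\<close> \<open>c < d\<close> by (simp add: norm_divide divide_simps)
    qed (use \<open>w 0 = 0\<close> z in auto)
    then show "norm (w z) / norm z \<le> d"
      using \<open>0 < d\<close> False by (simp add: norm_divide divide_simps mult.commute)
  qed
  then show ?thesis using False by (simp add: divide_simps)
qed

text \<open>With \<open>y = t * z\<close>, the \<open>t\<close>-derivative of
  \<open>t powr \<alpha> * p y\<close> is \<open>t powr (\<alpha> - 1)\<close> times
  \<open>y * deriv p y + \<alpha> * p y\<close>, so its norm is at most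
  \<open>c * norm z ^ n * t powr (n + \<alpha> - 1)\<close>; integrate over \<open>{0..1}\<close>.
  The general \<open>n\<close> covers both integrations: \<open>n = 1\<close> for
  \<open>deriv u\<close>, and \<open>n = 2\<close> with \<open>\<alpha> = 0\<close> for
  \<open>u\<close>.\<close>

lemma norm_le_of_Euler_operator:
  fixes p :: "complex \<Rightarrow> complex"
  assumes hol: "p holomorphic_on ball 0 1" and p0: "p 0 = 0"
    and "\<alpha> > -1" and "n \<ge> 1"
    and bound: "\<And>z. norm z < 1 \<Longrightarrow> norm (z * deriv p z + of_real \<alpha> * p z) \<le> c * norm z ^ n"
    and z: "norm z < 1"
  shows "norm (p z) \<le> c / (real n + \<alpha>) * norm z ^ n"
proof (cases "z = 0")
  case True
  then show ?thesis using p0 \<open>n \<ge> 1\<close> by (simp add: power_0_left)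
next
  case False
  \<comment> \<open>For \<open>\<alpha> < 0\<close> the factor \<open>t powr \<alpha>\<close> is
    unbounded near \<open>0\<close>; the zero of \<open>p\<close> contributes a factor
    \<open>t\<close>, and the exponent \<open>\<alpha> + 1\<close> is positive.\<close>
  obtain v where v: "v holomorphic_on ball 0 1" and pv: "\<And>z. norm z < 1 \<Longrightarrow> p z = z * v z"
    using Schwarz3[OF hol p0] by metis
  have deriv_v: "(v has_field_derivative deriv v x) (at x)" if "norm x < 1" for x
    using holomorphic_derivI[OF v open_ball, of x] that by simp
  have deriv_p: "deriv p x = v x + x * deriv v x" if "norm x < 1" for x
  proof -
    have "((\<lambda>z. z * v z) has_field_derivative v x + x * deriv v x) (at x)"
      using deriv_v[OF that] by (auto intro!: derivative_eq_intros)
    then have "(p has_field_derivative v x + x * deriv v x) (at x)"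
      by (rule has_field_derivative_transform_within_open[of _ _ _ "ball 0 1"])
        (use that pv in auto)
    then show ?thesis by (rule DERIV_imp_deriv)
  qed
  have tz: "norm (of_real t * z) < 1" if "0 \<le> t" "t \<le> 1" for t :: real
    using that le_less_trans[OF mult_left_le_one_le[of "norm z" t] z] by (simp add: norm_mult)
  \<comment> \<open>\<open>\<phi> t = t powr \<alpha> * p (t z)\<close>, written so that continuity at \<open>0\<close> is visible\<close>
  define \<phi> where "\<phi> t = t powr (\<alpha> + 1) *\<^sub>R (z * v (of_real t * z))" for t :: real
  define \<phi>' where "\<phi>' t = t powr (\<alpha> + 1) *\<^sub>R (z * (z * deriv v (of_real t * z)))
      + ((\<alpha> + 1) * t powr \<alpha>) *\<^sub>R (z * v (of_real t * z))" for t :: real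
  \<comment> \<open>Antiderivative of the bound on \<open>norm (\<phi>' t)\<close>. Both
    \<open>\<phi>\<close> and \<open>\<psi>\<close> vanish at \<open>0\<close>, since
    \<open>0 powr x = 0\<close>.\<close>
  define \<psi> where "\<psi> t = c * norm z ^ n / (real n + \<alpha>) * t powr (real n + \<alpha>)" for t :: real
  have pos: "real n + \<alpha> > 0" using \<open>\<alpha> > -1\<close> \<open>n \<ge> 1\<close> by linarith
  have "norm (\<phi> 1 - \<phi> 0) \<le> \<psi> 1 - \<psi> 0"
  \<comment> \<open>This mean value inequality needs continuity on \<open>{0..1}\<close> but
    derivatives only inside, so real powers of \<open>t\<close> cause no trouble at
    \<open>0\<close>.\<close>
  proof (rule differentiable_bound_general[where f' = \<phi>' and
        \<phi>' = "\<lambda>t. c * norm z ^ n * t powr (real n + \<alpha> - 1)"])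
    show "continuous_on {0..1} \<phi>"
      unfolding \<phi>_def using \<open>\<alpha> > -1\<close> tz
      by (intro continuous_intros continuous_on_powr'
          continuous_on_compose2[OF holomorphic_on_imp_continuous_on[OF v]]) auto
    show "continuous_on {0..1} \<psi>"
      unfolding \<psi>_def using pos by (intro continuous_intros continuous_on_powr') auto
    fix t :: real assume t: "0 < t" "t < 1"
    then have ntz: "norm (of_real t * z) < 1" using tz by simp
    have "((\<lambda>s. v (s * z)) has_field_derivative z * deriv v (of_real t * z)) (at (of_real t))"
      using DERIV_chain2[OF deriv_v[OF ntz] DERIV_cmult_right[OF DERIV_ident]]
      by (simp add: mult.commute)
    then have "((\<lambda>s. z * v (s * z)) has_field_derivative z * (z * deriv v (of_real t * z)))
        (at (of_real t))"
      by (rule DERIV_cmult)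
    then have v': "((\<lambda>s. z * v (of_real s * z)) has_vector_derivative
        z * (z * deriv v (of_real t * z))) (at t)"
      by (rule has_vector_derivative_real_field)
    have "((\<lambda>s. s powr (\<alpha> + 1)) has_real_derivative (\<alpha> + 1) * t powr \<alpha>) (at t)"
      using has_real_derivative_powr[OF t(1), of "\<alpha> + 1"] by simp
    from has_vector_derivative_scaleR[OF this v']
    show "(\<phi> has_vector_derivative \<phi>' t) (at t)" unfolding \<phi>_def \<phi>'_def .
    have "((\<lambda>t. c * norm z ^ n / (real n + \<alpha>) * t powr (real n + \<alpha>)) has_real_derivative
       c * norm z ^ n / (real n + \<alpha>) * ((real n + \<alpha>) * t powr (real n + \<alpha> - 1))) (at t)"
      by (rule DERIV_cmult[OF has_real_derivative_powr[OF t(1)]])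
    then show "(\<psi> has_vector_derivative c * norm z ^ n * t powr (real n + \<alpha> - 1)) (at t)"
      unfolding \<psi>_def has_real_derivative_iff_has_vector_derivative using pos by (simp add: mult.assoc)
    let ?y = "of_real t * z"
    have t1: "t powr (\<alpha> + 1) = t powr (\<alpha> - 1) * t * t" "t powr \<alpha> = t powr (\<alpha> - 1) * t"
      using t by (auto simp: powr_add powr_diff field_simps)
    have "\<phi>' t = of_real (t powr (\<alpha> - 1)) * (?y * deriv p ?y + of_real \<alpha> * p ?y)"
      unfolding \<phi>'_def deriv_p[OF ntz] pv[OF ntz] t1
      by (simp add: scaleR_conv_of_real algebra_simps)
    then have "norm (\<phi>' t) = t powr (\<alpha> - 1) * norm (?y * deriv p ?y + of_real \<alpha> * p ?y)"
      by (simp only: norm_mult norm_of_real) simp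
    also have "\<dots> \<le> t powr (\<alpha> - 1) * (c * norm ?y ^ n)"
      using bound[OF ntz] by (intro mult_left_mono) auto
    also have "\<dots> = c * norm z ^ n * (t powr (\<alpha> - 1) * t powr real n)"
      using t by (simp add: norm_mult power_mult_distrib powr_realpow)
    also have "t powr (\<alpha> - 1) * t powr real n = t powr (real n + \<alpha> - 1)"
      by (simp add: powr_add[symmetric] algebra_simps)
    finally show "norm (\<phi>' t) \<le> c * norm z ^ n * t powr (real n + \<alpha> - 1)" .
  qed simp
  then show ?thesis using pos pv[OF z] by (simp add: \<phi>_def \<psi>_def)
qed

lemma norm_le_of_second_order_operator:
  fixes u :: "complex \<Rightarrow> complex"
  assumes hol: "u holomorphic_on ball 0 1" and u0: "u 0 = 0" and u'0: "deriv u 0 = 0"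
    and "\<alpha> > -1"
    and bound: "\<And>z. norm z < 1 \<Longrightarrow> norm (z * deriv (deriv u) z + of_real \<alpha> * deriv u z) \<le> c"
    and z: "norm z < 1"
  shows "norm (u z) \<le> c / (2 * (1 + \<alpha>)) * (norm z)\<^sup>2"
proof -
  have hol': "deriv u holomorphic_on ball 0 1" "deriv (deriv u) holomorphic_on ball 0 1"
    using hol by (auto intro: holomorphic_deriv)
  \<comment> \<open>The operator vanishes at \<open>0\<close> because \<open>deriv u 0 = 0\<close>,
    so the Schwarz lemma improves \<open>c\<close> to \<open>c * norm z\<close>.\<close>
  have "norm (z * deriv (deriv u) z + of_real \<alpha> * deriv u z) \<le> c * norm z ^ 1"
    if "norm z < 1" for z
    unfolding power_one_right
    by (rule Schwarz_Lemma_le[where w = "\<lambda>z. z * deriv (deriv u) z + of_real \<alpha> * deriv u z"])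
      (use hol' u'0 bound that in \<open>auto intro!: holomorphic_intros\<close>)
  then have u': "norm (deriv u z) \<le> c / (1 + \<alpha>) * norm z" if "norm z < 1" for z
    using norm_le_of_Euler_operator[OF hol'(1) u'0 \<open>\<alpha> > -1\<close> order_refl _ that, of c] by simp
  \<comment> \<open>The zero term gives \<open>z * deriv u z\<close> the shape required for
    \<open>\<alpha> = 0\<close> and \<open>n = 2\<close>, whence the factor 1/2.\<close>
  have "norm (z * deriv u z + of_real 0 * u z) \<le> c / (1 + \<alpha>) * norm z ^ 2"
    if "norm z < 1" for z
    using mult_left_mono[OF u'[OF that] norm_ge_zero[of z]]
    by (simp add: norm_mult power2_eq_square mult_ac)
  then have "norm (u z) \<le> c / (1 + \<alpha>) / (real 2 + 0) * norm z ^ 2"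
    by (intro norm_le_of_Euler_operator[OF hol u0 _ _ _ z]) auto
  then show ?thesis by (simp add: mult.commute)
qed

section \<open>From harmonic mappings to holomorphic functions\<close>

lemma ex_unimodular_norm_add_cnj:
  obtains \<epsilon> :: complex where "norm \<epsilon> = 1" "norm (a + cnj b) = norm (a + \<epsilon> * b)"
proof (cases "b = 0")
  case True
  with that[of 1] show ?thesis by simp
next
  case False
  \<comment> \<open>This factor is unimodular and turns \<open>b\<close> into
    \<open>cnj b\<close>.\<close>
  with that[of "cnj b / b"] show ?thesis by (simp add: norm_divide)
qed

text \<open>Bounding \<open>f z - z\<close> rather than \<open>f z\<close> yields the upper and the
  lower growth bound together, by the triangle inequality.\<close>

lemma class_BH0_norm_diff_le:
  assumes "\<alpha> > -1" and f: "f \<in> class_BH0 \<alpha> \<beta>" and z: "norm z < 1"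
  shows "norm (f z - z) \<le> \<beta> / (2 * (1 + \<alpha>)) * (norm z)\<^sup>2"
proof -
  obtain h g where "harmonic_decomp f h g"
    and bd: "\<And>z. norm z < 1 \<Longrightarrow>
      norm (z * deriv (deriv h) z + of_real \<alpha> * (deriv h z - 1))
        \<le> \<beta> - norm (z * deriv (deriv g) z + of_real \<alpha> * deriv g z)"
    using f unfolding class_BH0_def by auto
  then have hol: "h holomorphic_on ball 0 1" "g holomorphic_on ball 0 1"
    and at0: "h 0 = 0" "g 0 = 0" "deriv h 0 = 1" "deriv g 0 = 0"
    and fz: "f z = h z + cnj (g z)"
    using z unfolding harmonic_decomp_def by auto
  obtain \<epsilon> where \<epsilon>: "norm \<epsilon> = 1" "norm (h z - z + cnj (g z)) = norm (h z - z + \<epsilon> * g z)"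
    by (rule ex_unimodular_norm_add_cnj)
  \<comment> \<open>The \<open>\<epsilon>\<close> chosen for the given \<open>z\<close> stays fixed
    over the whole disk, so that \<open>u\<close> is holomorphic.\<close>
  define u where "u = (\<lambda>z. h z - z + \<epsilon> * g z)"
  have D: "(F has_field_derivative deriv F x) (at x)"
    if "F holomorphic_on ball 0 1" "norm x < 1" for F and x :: complex
    using holomorphic_derivI[OF that(1) open_ball, of x] that(2) by simp
  have hol': "deriv h holomorphic_on ball 0 1" "deriv g holomorphic_on ball 0 1"
    using hol by (auto intro: holomorphic_deriv)
  have u': "deriv u x = deriv h x - 1 + \<epsilon> * deriv g x" if "norm x < 1" for x
    unfolding u_def
    by (rule DERIV_imp_deriv)
      (auto intro!: derivative_eq_intros D[OF hol(1) that] D[OF hol(2) that])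
  have u'': "deriv (deriv u) x = deriv (deriv h) x + \<epsilon> * deriv (deriv g) x"
    if "norm x < 1" for x
  proof -
    have "((\<lambda>x. deriv h x - 1 + \<epsilon> * deriv g x) has_field_derivative
        deriv (deriv h) x + \<epsilon> * deriv (deriv g) x) (at x)"
      by (auto intro!: derivative_eq_intros D[OF hol'(1) that] D[OF hol'(2) that])
    then have "(deriv u has_field_derivative
        deriv (deriv h) x + \<epsilon> * deriv (deriv g) x) (at x)"
      by (rule has_field_derivative_transform_within_open[of _ _ _ "ball 0 1"])
        (use that u' in auto)
    then show ?thesis by (rule DERIV_imp_deriv)
  qed
  \<comment> \<open>The class condition bounds the sum of the norms of the \<open>h\<close> and
    \<open>g\<close> parts, so a unimodular factor on the \<open>g\<close> part is harmless.\<close>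
  have "norm (x * deriv (deriv u) x + of_real \<alpha> * deriv u x) \<le> \<beta>" if "norm x < 1" for x
  proof -
    let ?P = "x * deriv (deriv h) x + of_real \<alpha> * (deriv h x - 1)"
    let ?Q = "x * deriv (deriv g) x + of_real \<alpha> * deriv g x"
    have "x * deriv (deriv u) x + of_real \<alpha> * deriv u x = ?P + \<epsilon> * ?Q"
      unfolding u'[OF that] u''[OF that] by (simp add: algebra_simps)
    also have "norm \<dots> \<le> norm ?P + norm ?Q"
      using norm_triangle_ineq[of ?P "\<epsilon> * ?Q"] \<epsilon>(1) by (simp only: norm_mult)
    also have "\<dots> \<le> \<beta>" using bd[OF that] by simp
    finally show ?thesis .
  qed
  then have "norm (u z) \<le> \<beta> / (2 * (1 + \<alpha>)) * (norm z)\<^sup>2"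
    by (intro norm_le_of_second_order_operator[OF _ _ _ \<open>\<alpha> > -1\<close> _ z])
      (use hol at0 u' in \<open>auto simp: u_def intro!: holomorphic_intros\<close>)
  moreover have "f z - z = h z - z + cnj (g z)" by (simp add: fz)
  ultimately show ?thesis using \<epsilon>(2) by (simp only: u_def)
qed

section \<open>Extremal functions and their rotations\<close>

lemma quadratic_mem_class_BH0:
  assumes "\<alpha> > -1" and AB: "2 * (1 + \<alpha>) * (norm A + norm B) \<le> \<beta>"
  shows "(\<lambda>z. z + A * z\<^sup>2 + cnj (B * z\<^sup>2)) \<in> class_BH0 \<alpha> \<beta>"
proof -
  let ?f = "\<lambda>z. z + A * z\<^sup>2 + cnj (B * z\<^sup>2)"
  let ?h = "\<lambda>z. z + A * z\<^sup>2" and ?g = "\<lambda>z. B * z\<^sup>2"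
  have h': "deriv ?h = (\<lambda>z. 1 + 2 * A * z)" and g': "deriv ?g = (\<lambda>z. 2 * B * z)"
    by (auto intro!: ext DERIV_imp_deriv derivative_eq_intros)
  have h'': "deriv (\<lambda>z. 1 + 2 * A * z) = (\<lambda>z. 2 * A)"
    and g'': "deriv (\<lambda>z. 2 * B * z) = (\<lambda>z. 2 * B)"
    by (auto intro!: ext DERIV_imp_deriv derivative_eq_intros)
  have decomp: "harmonic_decomp ?f ?h ?g"
    unfolding harmonic_decomp_def h' g' by (auto intro!: holomorphic_intros)
  \<comment> \<open>The operator acts on a quadratic monomial with coefficient \<open>C\<close> as
    \<open>2 * (1 + \<alpha>) * C * z\<close>; with \<open>norm z < 1\<close>, \<open>AB\<close>
    then gives the class condition.\<close>
  have N: "norm (z * (2 * C) + of_real \<alpha> * (2 * C * z)) = 2 * (1 + \<alpha>) * norm C * norm z"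
    for C z :: complex
  proof -
    have "z * (2 * C) + of_real \<alpha> * (2 * C * z) = of_real (2 * (1 + \<alpha>)) * C * z"
      by (simp add: algebra_simps)
    then show ?thesis using \<open>\<alpha> > -1\<close> by (simp only: norm_mult norm_of_real) simp
  qed
  have "norm (z * (2 * A) + of_real \<alpha> * (2 * A * z))
      \<le> \<beta> - norm (z * (2 * B) + of_real \<alpha> * (2 * B * z))" if "norm z < 1" for z
  proof -
    have "2 * (1 + \<alpha>) * (norm A + norm B) * norm z \<le> 2 * (1 + \<alpha>) * (norm A + norm B)"
      using that \<open>\<alpha> > -1\<close> by (intro mult_left_le) auto
    with AB show ?thesis unfolding N by (simp add: algebra_simps)
  qed
  then have "\<forall>z\<in>ball 0 1. norm (z * deriv (deriv ?h) z + of_real \<alpha> * (deriv ?h z - 1))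
      \<le> \<beta> - norm (z * deriv (deriv ?g) z + of_real \<alpha> * deriv ?g z)"
    unfolding h' g' h'' g'' by simp
  with decomp show ?thesis unfolding class_BH0_def class_H0_def by blast
qed

text \<open>At \<open>exp (- (\<i> * \<theta>)) * x\<close>, a point on the circle of
  \<open>x\<close>, the rotated function has norm \<open>norm (f x)\<close>, so the extremal points
  \<open>r\<close> and \<open>- r\<close> are carried along. Membership is a premise because
  \<open>F\<close> is arbitrary and may fail to be rotation invariant.\<close>

lemma sharp_for_rotation:
  assumes "(\<lambda>z. exp (- (\<i> * of_real \<theta>)) * f (exp (\<i> * of_real \<theta>) * z)) \<in> F"
    and "\<And>r. 0 < r \<Longrightarrow> r < 1 \<Longrightarrow> norm (f (of_real r)) = hi r"
    and "\<And>r. 0 < r \<Longrightarrow> r < 1 \<Longrightarrow> norm (f (- of_real r)) = lo r"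
  shows "sharp_for F lo hi (\<lambda>z. exp (- (\<i> * of_real \<theta>)) * f (exp (\<i> * of_real \<theta>) * z))"
proof -
  have "norm (exp (- (\<i> * of_real \<theta>)) * x) = norm x"
    and inv: "exp (\<i> * of_real \<theta>) * (exp (- (\<i> * of_real \<theta>)) * x) = x" for x
    by (auto simp: norm_mult simp flip: mult.assoc exp_add)
  then have "norm (exp (- (\<i> * of_real \<theta>)) * x) = norm x \<and>
      norm (exp (- (\<i> * of_real \<theta>)) * f (exp (\<i> * of_real \<theta>) * (exp (- (\<i> * of_real \<theta>)) * x)))
        = norm (f x)" for x
    unfolding inv by blast
  then show ?thesis unfolding sharp_for_def
    using assms by (smt (verit, best) greaterThanLessThan_iff norm_minus_cancel norm_of_real)
qed

theorem theorem2p3: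
  fixes \<alpha> \<beta> :: real
  assumes "\<alpha> > -1" and "\<beta> \<in> {0<..1 + \<alpha>}"
  shows "(\<forall>f \<in> class_BH0 \<alpha> \<beta>. \<forall>z \<in> ball 0 1.
            norm z - \<beta> / (2 * (1 + \<alpha>)) * (norm z)\<^sup>2 \<le> norm (f z) \<and>
            norm (f z) \<le> norm z + \<beta> / (2 * (1 + \<alpha>)) * (norm z)\<^sup>2) \<and>
         (\<forall>f \<in> rotations (\<lambda>z. z + of_real (\<beta> / (2 * (1 + \<alpha>))) * z\<^sup>2)
              \<union> rotations (\<lambda>z. z + of_real (\<beta> / (2 * (1 + \<alpha>))) * (cnj z)\<^sup>2).
            sharp_for (class_BH0 \<alpha> \<beta>)
              (\<lambda>r. r - \<beta> / (2 * (1 + \<alpha>)) * r\<^sup>2) (\<lambda>r. r + \<beta> / (2 * (1 + \<alpha>)) * r\<^sup>2) f)"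
proof -
  define c where "c = \<beta> / (2 * (1 + \<alpha>))"
  have c: "0 \<le> c" "c \<le> 1" "2 * (1 + \<alpha>) * c = \<beta>"
    using assms by (auto simp: c_def divide_simps)
  have bounds: "norm z - c * (norm z)\<^sup>2 \<le> norm (f z) \<and> norm (f z) \<le> norm z + c * (norm z)\<^sup>2"
    if "f \<in> class_BH0 \<alpha> \<beta>" "z \<in> ball 0 1" for f z
    using class_BH0_norm_diff_le[OF \<open>\<alpha> > -1\<close> that(1), of z, folded c_def] that(2)
      norm_triangle_ineq2[of z "f z"] norm_triangle_ineq2[of "f z" z]
    by (auto simp: norm_minus_commute)
  \<comment> \<open>\<open>z\<^sup>2\<close> and \<open>(cnj z)\<^sup>2\<close> agree on the real
    axis, so the values at \<open>r\<close> and \<open>- r\<close> serve both families.\<close>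
  have up: "norm (of_real r + of_real c * (of_real r)\<^sup>2 :: complex) = r + c * r\<^sup>2"
    and lo: "norm (- of_real r + of_real c * (of_real r)\<^sup>2 :: complex) = r - c * r\<^sup>2"
    if "0 < r" "r < 1" for r
  proof -
    have "(of_real r + of_real c * (of_real r)\<^sup>2 :: complex) = of_real (r + c * r\<^sup>2)" by simp
    then show "norm (of_real r + of_real c * (of_real r)\<^sup>2 :: complex) = r + c * r\<^sup>2"
      using that c(1) by (simp only: norm_of_real) simp
    \<comment> \<open>Here \<open>\<beta> \<le> 1 + \<alpha>\<close> enters, through
      \<open>c \<le> 1\<close>: the real value \<open>c * r\<^sup>2 - r\<close> is nonpositive, so
      its modulus is the lower bound.\<close>
    have "c * r\<^sup>2 \<le> r"
      using mult_mono[of "c * r" 1 r r] mult_le_one[of c r] that c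
      by (simp add: power2_eq_square mult.assoc)
    moreover have "(- of_real r + of_real c * (of_real r)\<^sup>2 :: complex) = of_real (c * r\<^sup>2 - r)"
      by simp
    ultimately show "norm (- of_real r + of_real c * (of_real r)\<^sup>2 :: complex) = r - c * r\<^sup>2"
      by (simp only: norm_of_real)
  qed
  have sharp1: "sharp_for (class_BH0 \<alpha> \<beta>) (\<lambda>r. r - c * r\<^sup>2) (\<lambda>r. r + c * r\<^sup>2)
      (\<lambda>z. exp (- (\<i> * of_real \<theta>)) * (exp (\<i> * of_real \<theta>) * z + of_real c *
          (exp (\<i> * of_real \<theta>) * z)\<^sup>2))" for \<theta> :: real
  proof (rule sharp_for_rotation[where f = "\<lambda>z. z + of_real c * z\<^sup>2"])
    have "(\<lambda>z. exp (- (\<i> * of_real \<theta>)) * (exp (\<i> * of_real \<theta>) * z + of_real c *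
          (exp (\<i> * of_real \<theta>) * z)\<^sup>2))
      = (\<lambda>z. z + of_real c * exp (\<i> * of_real \<theta>) * z\<^sup>2 + cnj (0 * z\<^sup>2))"
      by (auto simp: exp_minus power2_eq_square field_simps)
    then show "(\<lambda>z. exp (- (\<i> * of_real \<theta>)) * (exp (\<i> * of_real \<theta>) * z + of_real c *
          (exp (\<i> * of_real \<theta>) * z)\<^sup>2)) \<in> class_BH0 \<alpha> \<beta>"
      using quadratic_mem_class_BH0[OF \<open>\<alpha> > -1\<close>, of "of_real c * exp (\<i> * of_real \<theta>)" 0 \<beta>] c
      by (simp add: norm_mult)
  qed (use up lo in auto)
  have sharp2: "sharp_for (class_BH0 \<alpha> \<beta>) (\<lambda>r. r - c * r\<^sup>2) (\<lambda>r. r + c * r\<^sup>2)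
      (\<lambda>z. exp (- (\<i> * of_real \<theta>)) * (exp (\<i> * of_real \<theta>) * z + of_real c *
          (cnj (exp (\<i> * of_real \<theta>) * z))\<^sup>2))" for \<theta> :: real
  proof (rule sharp_for_rotation[where f = "\<lambda>z. z + of_real c * (cnj z)\<^sup>2"])
    \<comment> \<open>Conjugation turns the squared inner rotation into
      \<open>exp (- 2 * \<i> * \<theta>)\<close>, and the outer factor makes it
      \<open>exp (- 3 * \<i> * \<theta>)\<close>: a cube under \<open>cnj\<close>. The coefficient
      still has norm \<open>c\<close>, and \<open>2 * (1 + \<alpha>) * c = \<beta>\<close>.\<close>
    have "(\<lambda>z. exp (- (\<i> * of_real \<theta>)) * (exp (\<i> * of_real \<theta>) * z + of_real c *
          (cnj (exp (\<i> * of_real \<theta>) * z))\<^sup>2))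
      = (\<lambda>z. z + 0 * z\<^sup>2 + cnj (of_real c * exp (\<i> * of_real \<theta>) ^ 3 * z\<^sup>2))"
      by (auto simp: exp_cnj exp_minus power2_eq_square power3_eq_cube field_simps)
    then show "(\<lambda>z. exp (- (\<i> * of_real \<theta>)) * (exp (\<i> * of_real \<theta>) * z + of_real c *
          (cnj (exp (\<i> * of_real \<theta>) * z))\<^sup>2)) \<in> class_BH0 \<alpha> \<beta>"
      using quadratic_mem_class_BH0[OF \<open>\<alpha> > -1\<close>, of 0 "of_real c * exp (\<i> * of_real \<theta>) ^ 3" \<beta>] c
      by (simp add: norm_mult norm_power)
  qed (use up lo in auto)
  show ?thesis
    unfolding c_def[symmetric] rotations_def using bounds sharp1 sharp2 by blast
qed

end
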